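(* Let $n>1$ and let $R$ be a finite commutative ring with $1\neq 0$. Then: (1) $\pi_n(\mathcal{MT}_n)\cong\pi_n(\mathcal{ML}^n_n)\rtimes\cdots\rtimes\pi_2(\mathcal{ML}^2_2)\rtimes\mathcal{P}(R)$; (2) $\pi_n(\mathcal{MT}_n)\cong(\mathcal{F}(R^{n-1})\rtimes\mathcal{F}(R^{n-1})^\times)\rtimes\cdots\rtimes(\mathcal{F}(R)\rtimes\mathcal{F}(R)^\times)\rtimes\mathcal{P}(R)$; (3) $|\pi_n(\mathcal{MT}_n)|=|\mathcal{P}(R)|\times\prod_{i=1}^{n-1}|\mathcal{F}(R^i)|\,|\mathcal{F}(R^i)^\times|$.
   Context: $R_{[k]}=R[x_1,\ldots,x_k]$; $UV(R_{[k]})$ is the set of unit-valued polynomials ($g\in R_{[k]}$ with $g(a)\in R^\times$ for all $a\in R^k$). $\mathcal{F}(R^k)$ is the ring (pointwise operations) of polynomial functions $R^k\to R$, i.e. functions induced by elements of $R_{[k]}$, and $\mathcal{F}(R^k)^\times$ its group of units (for $R$ finite these are exactly the functions induced by unit-valued polynomials); $\mathcal{F}(R)=\mathcal{F}(R^1)$. $\mathcal{P}(R)$ is the group of permutations of $R$ induced by polynomials in $R[x]$. Composition of tuples of polynomials: $\vec f\circ\vec g=(f_1(\vec g),\ldots,f_m(\vec g))$. For $m>1$, $\mathcal{MT}_m$ is the monoid under $\circ$ of all tuples $(f_1,f_2+x_2u_2,\ldots,f_m+x_mu_m)$ with $f_1\in R[x_1]$ inducing a bijection of $R$, $f_i\in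 R_{[i-1]}$, $u_i\in UV(R_{[i-1]})$ ($2\le i\le m$). $\mathcal{ML}^m_k$ ($2\le k\le m$) is the submonoid of $\mathcal{MT}_m$ of elements $(x_1,\ldots,x_{k-1},f+x_ku,x_{k+1},\ldots,x_m)$ with $f\in R_{[k-1]}$, $u\in UV(R_{[k-1]})$. $\pi_m$ sends an $m$-tuple of polynomials in $R_{[m]}$ to the function $R^m\to R^m$ it induces; for $R$ finite $\pi_m(\mathcal{MT}_m)$ is a group of permutations of $R^m$. In $\mathcal{F}(R^k)\rtimes\mathcal{F}(R^k)^\times$ the first factor is the additive group of the ring. A group $B$ is the semi-direct product $A\rtimes C$ if there is a split short exact sequence $1\to A\to B\to C\to1$. Convention: $A_1\rtimes A_2\rtimes A_3$ means $A_1\rtimes(A_2\rtimes A_3)$, and similarly for more factors. *)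

theory Defs
  imports
    "HOL-Library.Poly_Mapping"
    "HOL-Computational_Algebra.Polynomial"
    "HOL-Algebra.Ring"
    "HOL-Algebra.Bij"
    "HOL-Algebra.Elementary_Groups"
begin

section \<open>Multivariate polynomials\<close>

text \<open>The finite commutative ring R is a type \<open>'a\<close>. A monomial is a finitely supported exponent
  function; variables are indexed by natural numbers and \<open>x\<^sub>i\<close> has index \<open>i\<close>, starting at 1.\<close>

type_synonym 'a mpoly = "(nat \<Rightarrow>\<^sub>0 nat) \<Rightarrow>\<^sub>0 'a"
type_synonym 'a point = "nat \<Rightarrow> 'a"
type_synonym 'a tuple = "nat \<Rightarrow> 'a mpoly"

definition polys :: "nat \<Rightarrow> 'a::comm_ring_1 mpoly set" where
  "polys k = {p. \<forall>e \<in> Poly_Mapping.keys p. Poly_Mapping.keys e \<subseteq> {1..k}}"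

definition Const :: "'a::comm_ring_1 \<Rightarrow> 'a mpoly" where
  "Const c = Poly_Mapping.single 0 c"

definition Var :: "nat \<Rightarrow> 'a::comm_ring_1 mpoly" where
  "Var i = Poly_Mapping.single (Poly_Mapping.single i 1) 1"

text \<open>Apply \<open>h\<close> to the coefficients and replace each \<open>x\<^sub>i\<close> by \<open>b i\<close>.\<close>

definition insertion ::
    "('a::comm_ring_1 \<Rightarrow> 'b::comm_ring_1) \<Rightarrow> (nat \<Rightarrow> 'b) \<Rightarrow> 'a mpoly \<Rightarrow> 'b" where
  "insertion h b p = (\<Sum>e \<in> Poly_Mapping.keys p. h (Poly_Mapping.lookup p e) *
     (\<Prod>i \<in> Poly_Mapping.keys e. b i ^ Poly_Mapping.lookup e i))"

definition evaluate :: "'a::comm_ring_1 point \<Rightarrow> 'a mpoly \<Rightarrow> 'a" where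
  "evaluate = insertion id"

definition substitute :: "'a::comm_ring_1 tuple \<Rightarrow> 'a mpoly \<Rightarrow> 'a mpoly" where
  "substitute = insertion Const"

text \<open>Points of \<open>R\<^sup>k\<close> are extensional: \<open>undefined\<close> outside \<open>{1..k}\<close>.\<close>

definition points :: "nat \<Rightarrow> 'a point set" where
  "points k = {1..k} \<rightarrow>\<^sub>E UNIV"

definition unit_valued :: "nat \<Rightarrow> 'a::comm_ring_1 mpoly set" where
  "unit_valued k = {g \<in> polys k. \<forall>a \<in> points k. evaluate a g dvd 1}"

text \<open>The ring of polynomial functions on \<open>R\<^sup>k\<close>.\<close>

definition polyfun_ring :: "nat \<Rightarrow> ('a::comm_ring_1 point \<Rightarrow> 'a) ring" where
  "polyfun_ring k =
     \<lparr>carrier = (\<lambda>p. \<lambda>a \<in> points k. evaluate a p) ` polys k,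
      mult = (\<lambda>f g. \<lambda>a \<in> points k. f a * g a),
      one = (\<lambda>a \<in> points k. 1),
      zero = (\<lambda>a \<in> points k. 0),
      add = (\<lambda>f g. \<lambda>a \<in> points k. f a + g a)\<rparr>"

definition polyperm_group :: "('a::comm_ring_1 \<Rightarrow> 'a) monoid" where
  "polyperm_group = BijGroup UNIV \<lparr>carrier := Bij UNIV \<inter> range poly\<rparr>"


section \<open>The monoids of triangular tuples\<close>

text \<open>\<open>Mtri m\<close> is the monoid of triangular tuples under composition.
  A polynomial in \<open>x\<^sub>1\<close> alone is evaluated at \<open>a\<close> by means of the constant point.\<close>

definition Mtri :: "nat \<Rightarrow> 'a::comm_ring_1 tuple monoid" where
  "Mtri m =
     \<lparr>carrier = {F \<in> {1..m} \<rightarrow>\<^sub>E UNIV.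
        F 1 \<in> polys 1 \<and> bij (\<lambda>a. evaluate (\<lambda>_. a) (F 1)) \<and>
        (\<forall>i \<in> {2..m}. \<exists>f \<in> polys (i - 1). \<exists>u \<in> unit_valued (i - 1). F i = f + Var i * u)},
      mult = (\<lambda>F G. \<lambda>i \<in> {1..m}. substitute G (F i)),
      one = (\<lambda>i \<in> {1..m}. Var i)\<rparr>"

text \<open>Tuples in \<open>Mlin m k\<close> have \<open>m\<close> entries; only entry \<open>k\<close> may differ from the identity.\<close>

definition Mlin :: "nat \<Rightarrow> nat \<Rightarrow> 'a::comm_ring_1 tuple monoid" where
  "Mlin m k = Mtri m \<lparr>carrier := {F \<in> carrier (Mtri m).
     (\<forall>i \<in> {1..m} - {k}. F i = Var i) \<and>
     (\<exists>f \<in> polys (k - 1). \<exists>u \<in> unit_valued (k - 1). F k = f + Var k * u)}\<rparr>"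

definition tuple_fun :: "nat \<Rightarrow> 'a::comm_ring_1 tuple \<Rightarrow> 'a point \<Rightarrow> 'a point" where
  "tuple_fun m F = (\<lambda>a \<in> points m. \<lambda>i \<in> {1..m}. evaluate a (F i))"

text \<open>The image of a monoid of tuples, with the composition of permutations of \<open>R\<^sup>m\<close>.
  The multiplication of \<open>BijGroup\<close> is composition only on bijections; for finite \<open>R\<close> all tuples
  in \<open>Mtri m\<close> induce bijections.\<close>

definition induced_group ::
    "nat \<Rightarrow> 'a::comm_ring_1 tuple monoid \<Rightarrow> ('a point \<Rightarrow> 'a point) monoid" where
  "induced_group m M = BijGroup (points m) \<lparr>carrier := tuple_fun m ` carrier M\<rparr>"


section \<open>Semidirect products\<close>

text \<open>\<open>B\<close> is a semidirect product \<open>A \<rtimes> C\<close>: a split short exact sequence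
  \<open>1 \<rightarrow> A \<rightarrow> B \<rightarrow> C \<rightarrow> 1\<close>. The condition depends only on the isomorphism types of the groups.\<close>

definition semidirect :: "'a monoid \<Rightarrow> 'b monoid \<Rightarrow> 'c monoid \<Rightarrow> bool" where
  "semidirect A B C \<longleftrightarrow> group A \<and> group B \<and> group C \<and>
     (\<exists>i p s. i \<in> mon A B \<and> p \<in> epi B C \<and> kernel B C p = i ` carrier A \<and>
        s \<in> hom C B \<and> (\<forall>c \<in> carrier C. p (s c) = c))"

text \<open>\<open>iterated_semidirect [A\<^sub>1, \<dots>, A\<^sub>r] H B\<close>: the group \<open>B\<close> is isomorphic to
  \<open>A\<^sub>1 \<rtimes> (A\<^sub>2 \<rtimes> (\<dots> \<rtimes> (A\<^sub>r \<rtimes> H)))\<close>. Taking \<open>C\<close> over the element type of \<open>B\<close> is no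
  restriction, since the section embeds \<open>C\<close> into \<open>B\<close>.\<close>

fun iterated_semidirect :: "'a monoid list \<Rightarrow> 'b monoid \<Rightarrow> 'c monoid \<Rightarrow> bool" where
  "iterated_semidirect [] H B \<longleftrightarrow> group H \<and> group B \<and> B \<cong> H"
| "iterated_semidirect (A # As) H B \<longleftrightarrow>
     (\<exists>C :: 'c monoid. semidirect A B C \<and> iterated_semidirect As H C)"

text \<open>For a ring \<open>R\<close>, the semidirect product of the additive group and the unit group, the units
  acting by multiplication.\<close>

definition add_units_semidirect :: "('a, 'm) ring_scheme \<Rightarrow> ('a \<times> 'a) monoid" where
  "add_units_semidirect R =
     \<lparr>carrier = carrier R \<times> Units R,
      mult = (\<lambda>(f, u) (g, v). (f \<oplus>\<^bsub>R\<^esub> u \<otimes>\<^bsub>R\<^esub> g, u \<otimes>\<^bsub>R\<^esub> v)),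
      one = (\<zero>\<^bsub>R\<^esub>, \<one>\<^bsub>R\<^esub>)\<rparr>"

lemma semidirect_add_units:
  fixes R :: "'a ring" (structure)
  assumes "ring R"
  shows "semidirect (add_monoid R) (add_units_semidirect R) (units_of R)"
proof -
  interpret ring R by fact
  let ?B = "add_units_semidirect R"
  have gB: "group ?B"
  proof (rule groupI)
    fix x assume "x \<in> carrier ?B"
    then obtain f u where x: "x = (f, u)" "f \<in> carrier R" "u \<in> Units R"
      by (auto simp: add_units_semidirect_def)
    let ?y = "(\<ominus> (inv u \<otimes> f), inv u)"
    have "?y \<in> carrier ?B" "?y \<otimes>\<^bsub>?B\<^esub> x = \<one>\<^bsub>?B\<^esub>"
      using x by (auto simp: add_units_semidirect_def l_neg)
    then show "\<exists>y \<in> carrier ?B. y \<otimes>\<^bsub>?B\<^esub> x = \<one>\<^bsub>?B\<^esub>" by blast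
  qed (auto simp: add_units_semidirect_def m_assoc a_assoc r_distr Units_closed)
  have "(\<lambda>f. (f, \<one>)) \<in> mon (add_monoid R) ?B"
    by (auto simp: mon_def hom_def inj_on_def add_units_semidirect_def)
  moreover have "snd \<in> epi ?B (units_of R)"
    by (force simp: epi_def hom_def add_units_semidirect_def units_of_def)
  moreover have "kernel ?B (units_of R) snd = (\<lambda>f. (f, \<one>)) ` carrier (add_monoid R)"
    by (auto simp: kernel_def add_units_semidirect_def units_of_def)
  moreover have "(\<lambda>u. (\<zero>, u)) \<in> hom (units_of R) ?B"
    by (auto simp: hom_def add_units_semidirect_def units_of_def)
  moreover have "\<forall>u \<in> carrier (units_of R). snd (\<zero>, u) = u" by simp
  ultimately show ?thesis
    unfolding semidirect_def using gB units_group a_group by blast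
qed

end

theory Submission
  imports Defs
begin

text \<open>A triangular map of \<open>R\<^sup>m\<^sup>+\<^sup>1\<close> is determined by a triangular map \<open>h\<close> of \<open>R\<^sup>m\<close>, a polynomial function
  \<open>f\<close> and a unit \<open>u\<close> of the ring of polynomial functions on \<open>R\<^sup>m\<close>: it sends \<open>(b, c)\<close> to
  \<open>(h b, f b + c * u b)\<close>, and \<open>h\<close>, \<open>f\<close>, \<open>u\<close> are recovered by putting \<open>c = 0\<close> and \<open>c = 1\<close>. Forgetting
  the last coordinate is a split homomorphism \<open>(h, f, u) \<mapsto> h\<close>, and on its kernel composition is the
  multiplication \<open>(f, u) (g, v) = (f + u g, u v)\<close>. All three claims follow by induction on \<open>m\<close>.\<close>

section \<open>Evaluation of polynomials\<close>

definition monomial_value :: "'a::comm_ring_1 point \<Rightarrow> (nat \<Rightarrow>\<^sub>0 nat) \<Rightarrow> 'a" where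
  "monomial_value a e = (\<Prod>i \<in> Poly_Mapping.keys e. a i ^ Poly_Mapping.lookup e i)"

text \<open>An exponent outside the support is 0 and contributes a factor 1, so several monomials
  can be compared over one common index set.\<close>

lemma monomial_value_superset:
  assumes "finite S" "Poly_Mapping.keys e \<subseteq> S"
  shows "monomial_value a e = (\<Prod>i \<in> S. a i ^ Poly_Mapping.lookup e i)"
  unfolding monomial_value_def
  by (rule prod.mono_neutral_left) (use assms in \<open>auto simp: in_keys_iff\<close>)

lemma monomial_value_add: "monomial_value a (e + e') = monomial_value a e * monomial_value a e'"
proof -
  let ?S = "Poly_Mapping.keys e \<union> Poly_Mapping.keys e'"
  have "Poly_Mapping.keys (e + e') \<subseteq> ?S"
    by (rule keys_add)
  then show ?thesis
    by (simp add: monomial_value_superset[of ?S] lookup_add power_add prod.distrib)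
qed

lemma evaluate_def': "evaluate a p =
    (\<Sum>e \<in> Poly_Mapping.keys p. Poly_Mapping.lookup p e * monomial_value a e)"
  by (simp add: evaluate_def insertion_def monomial_value_def)

lemma evaluate_zero [simp]: "evaluate a 0 = 0"
  by (simp add: evaluate_def')

lemma evaluate_single: "evaluate a (Poly_Mapping.single e c) = c * monomial_value a e"
  by (simp add: evaluate_def')

lemma evaluate_add [simp]: "evaluate a (p + q) = evaluate a p + evaluate a q"
  unfolding evaluate_def'
  by (rule setsum_keys_plus_distrib) (simp_all add: algebra_simps)

text \<open>A finitely supported function arises from 0 by adding one term at a time. The step is a
  sum and not an update, which is the form that additivity and distributivity can use.\<close>

lemma poly_mapping_add_induct [case_names zero add]:
  assumes "P 0"
    and "\<And>e c p. P p \<Longrightarrow> P (Poly_Mapping.single e c + p)"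
  shows "P (p :: 'b \<Rightarrow>\<^sub>0 'c::comm_monoid_add)"
proof (induction p rule: update_induct)
  case const
  show ?case by (rule assms(1))
next
  case (update f e c)
  have "Poly_Mapping.update e c f = Poly_Mapping.single e c + f"
    using update(1)
    by (intro poly_mapping_eqI) (auto simp: lookup_update lookup_add lookup_single when_def in_keys_iff)
  with assms(2)[OF update(3)] show ?case by simp
qed

text \<open>One half of multiplicativity: expanding the right factor reduces the claim to the
  addition of exponents. \<open>evaluate_mult\<close> then expands the left factor.\<close>

lemma evaluate_single_mult:
  "evaluate a (Poly_Mapping.single e c * q) = c * monomial_value a e * evaluate a q"
proof (induction q rule: poly_mapping_add_induct)
  case (add e' c' q)
  have "evaluate a (Poly_Mapping.single e c * Poly_Mapping.single e' c') =
      c * monomial_value a e * evaluate a (Poly_Mapping.single e' c')"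
    by (simp add: mult_single evaluate_single monomial_value_add mult_ac)
  with add show ?case
    by (simp only: distrib_left evaluate_add)
qed simp

lemma evaluate_mult [simp]: "evaluate a (p * q) = evaluate a p * evaluate a q"
proof (induction p rule: poly_mapping_add_induct)
  case (add e c p)
  then show ?case
    by (simp only: distrib_right evaluate_add evaluate_single_mult evaluate_single)
qed simp

lemma evaluate_Const [simp]: "evaluate a (Const c) = c"
  by (simp add: Const_def evaluate_single monomial_value_def)

lemma Const_one: "Const 1 = 1"
  by (simp add: Const_def)

lemma evaluate_one [simp]: "evaluate a 1 = 1"
  by (simp flip: Const_one)

lemma evaluate_Var [simp]: "evaluate a (Var i) = a i"
  by (simp add: Var_def evaluate_single monomial_value_def)

lemma evaluate_sum: "evaluate a (sum f S) = (\<Sum>x\<in>S. evaluate a (f x))"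
  by (induction S rule: infinite_finite_induct) simp_all

lemma evaluate_prod: "evaluate a (prod f S) = (\<Prod>x\<in>S. evaluate a (f x))"
  by (induction S rule: infinite_finite_induct) simp_all

lemma evaluate_power: "evaluate a (p ^ n) = evaluate a p ^ n"
  by (induction n) simp_all

text \<open>Evaluation at \<open>a\<close> is a ring homomorphism that takes \<open>Const c\<close>
  to \<open>c\<close>, so it passes through the sums, products and powers that make up a
  substitution.\<close>

lemma evaluate_substitute:
  "evaluate a (substitute G p) = evaluate (\<lambda>i. evaluate a (G i)) p"
  by (simp add: substitute_def insertion_def evaluate_sum evaluate_prod evaluate_power
      evaluate_def'[where p = p] monomial_value_def)

text \<open>Only variables with index in \<open>{1..k}\<close> occur in \<open>p\<close>. This moves
  values between points of different dimension, and between an extensional point of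
  \<open>R^1\<close> and a constant point.\<close>

lemma evaluate_cong:
  assumes "p \<in> polys k" "\<And>i. i \<in> {1..k} \<Longrightarrow> a i = b i"
  shows "evaluate a p = evaluate b p"
proof -
  have "monomial_value a e = monomial_value b e" if "e \<in> Poly_Mapping.keys p" for e
  proof -
    have "Poly_Mapping.keys e \<subseteq> {1..k}"
      using assms(1) that by (simp add: polys_def)
    then show ?thesis
      unfolding monomial_value_def using assms(2) by (intro prod.cong) auto
  qed
  then show ?thesis
    by (simp add: evaluate_def')
qed

section \<open>Closure properties of the polynomials in the first \<open>k\<close> variables\<close>

lemma polys_mono: "k \<le> l \<Longrightarrow> p \<in> polys k \<Longrightarrow> p \<in> polys l"
  by (force simp: polys_def)

lemma polys_Const [simp]: "Const c \<in> polys k"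
  by (simp add: polys_def Const_def)

lemma polys_zero [simp]: "0 \<in> polys k"
  by (simp add: polys_def)

lemma polys_one [simp]: "1 \<in> polys k"
  by (simp add: polys_def)

lemma polys_Var: "1 \<le> i \<Longrightarrow> i \<le> k \<Longrightarrow> Var i \<in> polys k"
  by (simp add: polys_def Var_def)

lemma polys_add: "p \<in> polys k \<Longrightarrow> q \<in> polys k \<Longrightarrow> p + q \<in> polys k"
  using keys_add[of p q] by (auto simp: polys_def)

lemma polys_mult:
  assumes "p \<in> polys k" "q \<in> polys k"
  shows "p * q \<in> polys k"
  unfolding polys_def
proof (intro CollectI ballI)
  fix e assume "e \<in> Poly_Mapping.keys (p * q)"
  then obtain b c where "e = b + c" "b \<in> Poly_Mapping.keys p" "c \<in> Poly_Mapping.keys q"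
    using keys_mult[of p q] by blast
  then show "Poly_Mapping.keys e \<subseteq> {1..k}"
    using assms keys_add[of b c] by (force simp: polys_def)
qed

lemma polys_sum: "(\<And>x. x \<in> S \<Longrightarrow> f x \<in> polys k) \<Longrightarrow> sum f S \<in> polys k"
  by (induction S rule: infinite_finite_induct) (simp_all add: polys_add)

lemma polys_prod: "(\<And>x. x \<in> S \<Longrightarrow> f x \<in> polys k) \<Longrightarrow> prod f S \<in> polys k"
  by (induction S rule: infinite_finite_induct) (simp_all add: polys_mult)

lemma polys_power: "p \<in> polys k \<Longrightarrow> p ^ n \<in> polys k"
  by (induction n) (simp_all add: polys_mult)

lemma polys_substitute:
  assumes "p \<in> polys l" "\<And>i. i \<in> {1..l} \<Longrightarrow> G i \<in> polys k"
  shows "substitute G p \<in> polys k"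
  unfolding substitute_def insertion_def
proof (intro polys_sum polys_mult polys_Const polys_prod polys_power assms(2))
  fix e i assume "e \<in> Poly_Mapping.keys p" "i \<in> Poly_Mapping.keys e"
  then show "i \<in> {1..l}"
    using assms(1) unfolding polys_def by blast
qed


section \<open>Rings of polynomial functions\<close>

abbreviation polyfuns :: "nat \<Rightarrow> ('a::comm_ring_1 point \<Rightarrow> 'a) set" where
  "polyfuns k \<equiv> carrier (polyfun_ring k)"

abbreviation unitfuns :: "nat \<Rightarrow> ('a::comm_ring_1 point \<Rightarrow> 'a) set" where
  "unitfuns k \<equiv> Units (polyfun_ring k)"

lemma carrier_polyfun_ring:
  "polyfuns k = (\<lambda>p. \<lambda>a \<in> points k. evaluate a p) ` polys k"
  by (simp add: polyfun_ring_def)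

lemma polyfun_ring_ops:
  "f \<otimes>\<^bsub>polyfun_ring k\<^esub> g = (\<lambda>a \<in> points k. f a * g a)"
  "f \<oplus>\<^bsub>polyfun_ring k\<^esub> g = (\<lambda>a \<in> points k. f a + g a)"
  "\<one>\<^bsub>polyfun_ring k\<^esub> = (\<lambda>a \<in> points k. 1)"
  "\<zero>\<^bsub>polyfun_ring k\<^esub> = (\<lambda>a \<in> points k. 0)"
  by (simp_all add: polyfun_ring_def)

lemma polyfuns_I: "p \<in> polys k \<Longrightarrow> f = (\<lambda>a \<in> points k. evaluate a p) \<Longrightarrow> f \<in> polyfuns k"
  by (auto simp: carrier_polyfun_ring)

lemma polyfuns_E:
  assumes "f \<in> polyfuns k"
  obtains p where "p \<in> polys k" "f = (\<lambda>a \<in> points k. evaluate a p)"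
  using assms by (auto simp: carrier_polyfun_ring)

lemma polyfuns_ext: "f \<in> polyfuns k \<Longrightarrow> f \<in> extensional (points k)"
  by (auto simp: carrier_polyfun_ring)

lemma polyfuns_add:
  assumes "f \<in> polyfuns k" "g \<in> polyfuns k"
  shows "(\<lambda>a \<in> points k. f a + g a) \<in> polyfuns k"
proof -
  obtain p q where "p \<in> polys k" "f = (\<lambda>a \<in> points k. evaluate a p)"
      "q \<in> polys k" "g = (\<lambda>a \<in> points k. evaluate a q)"
    using assms by (blast elim: polyfuns_E)
  then show ?thesis
    by (intro polyfuns_I[of "p + q"] restrict_ext) (auto intro: polys_add)
qed

lemma polyfuns_mult:
  assumes "f \<in> polyfuns k" "g \<in> polyfuns k"
  shows "(\<lambda>a \<in> points k. f a * g a) \<in> polyfuns k"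
proof -
  obtain p q where "p \<in> polys k" "f = (\<lambda>a \<in> points k. evaluate a p)"
      "q \<in> polys k" "g = (\<lambda>a \<in> points k. evaluate a q)"
    using assms by (blast elim: polyfuns_E)
  then show ?thesis
    by (intro polyfuns_I[of "p * q"] restrict_ext) (auto intro: polys_mult)
qed

lemma polyfuns_const: "(\<lambda>a \<in> points k. c) \<in> polyfuns k"
  by (rule polyfuns_I[of "Const c"]) auto

text \<open>Polynomials \<open>G i\<close> representing the coordinates of \<open>h\<close> are
  substituted into a polynomial representing \<open>f\<close>. Composition of triangular maps calls
  for this, since it evaluates the outer data at the image of the inner map.\<close>

lemma polyfuns_comp:
  assumes "f \<in> polyfuns l" "\<And>i. i \<in> {1..l} \<Longrightarrow> (\<lambda>a \<in> points k. h a i) \<in> polyfuns k"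
    and "\<And>a. a \<in> points k \<Longrightarrow> h a \<in> points l"
  shows "(\<lambda>a \<in> points k. f (h a)) \<in> polyfuns k"
proof -
  obtain p where p: "p \<in> polys l" "f = (\<lambda>a \<in> points l. evaluate a p)"
    using assms(1) by (rule polyfuns_E)
  have "\<forall>i \<in> {1..l}. \<exists>q. q \<in> polys k \<and> (\<lambda>a \<in> points k. h a i) = (\<lambda>a \<in> points k. evaluate a q)"
    using assms(2) by (blast elim: polyfuns_E)
  then obtain G where G: "\<And>i. i \<in> {1..l} \<Longrightarrow> G i \<in> polys k"
      "\<And>i. i \<in> {1..l} \<Longrightarrow> (\<lambda>a \<in> points k. h a i) = (\<lambda>a \<in> points k. evaluate a (G i))"
    by metis
  have "f (h a) = evaluate a (substitute G p)" if "a \<in> points k" for a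
  proof -
    have "f (h a) = evaluate (h a) p"
      using assms(3)[OF that] p by simp
    also have "\<dots> = evaluate (\<lambda>i. evaluate a (G i)) p"
      by (rule evaluate_cong[OF p(1)]) (use fun_cong[OF G(2), of _ a] that in simp)
    finally show ?thesis by (simp add: evaluate_substitute)
  qed
  then show ?thesis
    using p G by (intro polyfuns_I[of "substitute G p"]) (auto intro: polys_substitute)
qed

lemma cring_polyfun_ring: "cring (polyfun_ring k :: ('a::comm_ring_1 point \<Rightarrow> 'a) ring)"
proof (rule cringI)
  let ?R = "polyfun_ring k :: ('a point \<Rightarrow> 'a) ring"
  note * = polyfun_ring_ops polyfuns_add polyfuns_mult polyfuns_const
  show "abelian_group ?R"
  proof (rule abelian_groupI)
    fix f :: "'a point \<Rightarrow> 'a" assume "f \<in> carrier ?R"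
    \<comment> \<open>The additive inverse is built as the product with the constant function
      \<open>-1\<close>, so that closure under products yields its membership.\<close>
    then have "(\<lambda>a \<in> points k. (\<lambda>a \<in> points k. - 1) a * f a) \<in> carrier ?R"
      by (intro polyfuns_mult polyfuns_const)
    moreover have "(\<lambda>a \<in> points k. (\<lambda>a \<in> points k. - 1) a * f a) \<oplus>\<^bsub>?R\<^esub> f = \<zero>\<^bsub>?R\<^esub>"
      by (auto simp: polyfun_ring_ops intro!: restrict_ext)
    ultimately show "\<exists>g \<in> carrier ?R. g \<oplus>\<^bsub>?R\<^esub> f = \<zero>\<^bsub>?R\<^esub>" by blast
  next
    fix f :: "'a point \<Rightarrow> 'a" assume "f \<in> carrier ?R"
    then have "f \<in> extensional (points k)" by (rule polyfuns_ext)
    then show "\<zero>\<^bsub>?R\<^esub> \<oplus>\<^bsub>?R\<^esub> f = f"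
      by (intro extensionalityI[of _ "points k"]) (auto simp: polyfun_ring_ops)
  qed (auto simp: * algebra_simps intro!: restrict_ext)
  show "comm_monoid ?R"
  proof (rule comm_monoidI)
    fix f :: "'a point \<Rightarrow> 'a" assume "f \<in> carrier ?R"
    then have "f \<in> extensional (points k)" by (rule polyfuns_ext)
    then show "\<one>\<^bsub>?R\<^esub> \<otimes>\<^bsub>?R\<^esub> f = f"
      by (intro extensionalityI[of _ "points k"]) (auto simp: polyfun_ring_ops)
  qed (auto simp: * algebra_simps intro!: restrict_ext)
qed (auto simp: polyfun_ring_ops algebra_simps intro!: restrict_ext)

lemma finite_points: "finite (points k :: 'a::finite point set)"
  unfolding points_def by (intro finite_PiE) auto

lemma finite_polyfuns: "finite (polyfuns k :: ('a::{finite,comm_ring_1} point \<Rightarrow> 'a) set)"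
proof (rule finite_subset)
  show "polyfuns k \<subseteq> points k \<rightarrow>\<^sub>E (UNIV :: 'a set)"
    using polyfuns_ext by (auto simp: PiE_def)
qed (simp add: finite_PiE finite_points)

text \<open>Multiplication by a pointwise invertible polynomial function is injective on the finite
  ring, hence reaches the constant 1; so the pointwise inverse is again polynomial.\<close>

lemma unitfuns_iff:
  fixes f :: "'a::{finite,comm_ring_1} point \<Rightarrow> 'a"
  shows "f \<in> unitfuns k \<longleftrightarrow> f \<in> polyfuns k \<and> (\<forall>a \<in> points k. f a dvd 1)"
proof (intro iffI conjI ballI)
  assume "f \<in> unitfuns k"
  then show "f \<in> polyfuns k"
    by (simp add: Units_def)
next
  fix a :: "'a point"
  assume "f \<in> unitfuns k" and a: "a \<in> points k"
  then obtain g where "(\<lambda>a \<in> points k. f a * g a) = (\<lambda>a \<in> points k. 1)"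
    unfolding Units_def polyfun_ring_ops by blast
  from fun_cong[OF this, of a] have "1 = f a * g a"
    using a by simp
  then show "f a dvd 1" by (rule dvdI)
next
  assume "f \<in> polyfuns k \<and> (\<forall>a \<in> points k. f a dvd 1)"
  then have f: "f \<in> polyfuns k" and u: "\<And>a. a \<in> points k \<Longrightarrow> f a dvd 1"
    by blast+
  let ?m = "\<lambda>g. \<lambda>a \<in> points k. f a * g a"
  have "inj_on ?m (polyfuns k)"
  proof (rule inj_onI)
    fix g h assume gh: "g \<in> polyfuns k" "h \<in> polyfuns k" "?m g = ?m h"
    show "g = h"
    proof (rule extensionalityI[OF polyfuns_ext[OF gh(1)] polyfuns_ext[OF gh(2)]])
      fix a :: "'a point" assume a: "a \<in> points k"
      then have "f a * g a = f a * h a"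
        using fun_cong[OF gh(3), of a] by simp
      moreover obtain v where v: "1 = f a * v" using u[OF a] by (rule dvdE)
      ultimately have "v * f a * g a = v * f a * h a"
        by (simp only: mult.assoc)
      then show "g a = h a"
        using v by (simp add: mult.commute)
    qed
  qed
  then have "?m ` polyfuns k = polyfuns k"
    using f by (intro endo_inj_surj finite_polyfuns) (auto intro: polyfuns_mult)
  then have "(\<lambda>a \<in> points k. 1) \<in> ?m ` polyfuns k"
    using polyfuns_const by simp
  then obtain g where g: "g \<in> polyfuns k" "(\<lambda>a \<in> points k. 1) = ?m g"
    by (rule imageE)
  have "(\<lambda>a \<in> points k. g a * f a) = ?m g"
    by (simp add: mult.commute)
  with f g show "f \<in> unitfuns k"
    unfolding Units_def polyfun_ring_ops by auto
qed

text \<open>Translates between the unit-valued polynomials in triangular tuples and the units of the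
  function ring, by the pointwise criterion for units over a finite ring.\<close>

lemma unitfuns_eq:
  "(unitfuns k :: ('a::{finite,comm_ring_1} point \<Rightarrow> 'a) set) =
     (\<lambda>p. \<lambda>a \<in> points k. evaluate a p) ` unit_valued k"
  by (auto simp: unitfuns_iff carrier_polyfun_ring unit_valued_def)


section \<open>Groups of triangular maps\<close>

text \<open>Left translation by \<open>x\<close> is injective on \<open>H\<close>, hence onto by
  finiteness. Some element of \<open>H\<close> is therefore taken to the identity, and this element
  is the inverse of \<open>x\<close>.\<close>

lemma finite_submonoid_imp_subgroup:
  assumes "group G" "finite H" "H \<subseteq> carrier G" "\<one>\<^bsub>G\<^esub> \<in> H"
    and closed: "\<And>x y. x \<in> H \<Longrightarrow> y \<in> H \<Longrightarrow> x \<otimes>\<^bsub>G\<^esub> y \<in> H"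
  shows "subgroup H G"
proof -
  interpret group G by fact
  have "inv\<^bsub>G\<^esub> x \<in> H" if x: "x \<in> H" for x
  proof -
    have "(\<lambda>y. x \<otimes>\<^bsub>G\<^esub> y) ` H = H"
    proof (rule endo_inj_surj[OF assms(2)])
      show "inj_on (\<lambda>y. x \<otimes>\<^bsub>G\<^esub> y) H"
        using x assms(3) by (meson inj_on_cmult inj_on_subset subsetD)
    qed (use closed x in auto)
    then obtain y where "y \<in> H" "x \<otimes>\<^bsub>G\<^esub> y = \<one>\<^bsub>G\<^esub>"
      using assms(4) by (metis imageE)
    then show ?thesis
      using x assms(3) by (metis inv_equality inv_inv inv_closed subsetD)
  qed
  then show ?thesis
    using assms by (intro subgroup.intro) auto
qed

text \<open>Used for the polynomial permutations, the triangular maps and the kernels alike: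
  inverses come from finiteness, so no inverse of such a map has to be written down.\<close>

lemma group_finite_maps:
  assumes "finite K" "K \<subseteq> Bij S" "(\<lambda>x \<in> S. x) \<in> K"
    and "\<And>g h. g \<in> K \<Longrightarrow> h \<in> K \<Longrightarrow> compose S g h \<in> K"
  shows "group (BijGroup S \<lparr>carrier := K\<rparr>)"
proof -
  have "subgroup K (BijGroup S)"
    using assms
    by (intro finite_submonoid_imp_subgroup group_BijGroup) (auto simp: BijGroup_def subset_iff)
  then show ?thesis
    using group_BijGroup by (rule subgroup.subgroup_is_group)
qed

section \<open>Splitting off the last coordinate\<close>

lemma points_upd: "a \<in> points m \<Longrightarrow> a(Suc m := c) \<in> points (Suc m)"
  by (auto simp: points_def PiE_def extensional_def)

lemma points_restrict: "restrict a {1..m} \<in> points m"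
  by (simp add: points_def)

lemma restrict_points: "a \<in> points m \<Longrightarrow> restrict a {1..m} = a"
  by (simp add: points_def PiE_def extensional_restrict)

lemma restrict_upd_points: "a \<in> points m \<Longrightarrow> restrict (a(Suc m := c)) {1..m} = a"
  by (auto simp: points_def PiE_def extensional_def restrict_def)

lemma upd_restrict_points: "a \<in> points (Suc m) \<Longrightarrow> (restrict a {1..m})(Suc m := a (Suc m)) = a"
  by (rule ext) (auto simp: points_def PiE_def extensional_def le_Suc_eq)

text \<open>\<open>b(Suc m := c)\<close> plays the role of the pair \<open>(b, c)\<close>, and
  restriction to \<open>{1..m}\<close> gives back \<open>b\<close> as an extensional point. The map
  itself is extensional because \<open>Bij\<close> asks for that.\<close>

definition tri_ext ::
    "nat \<Rightarrow> ('a::comm_ring_1 point \<Rightarrow> 'a point) \<Rightarrow> ('a point \<Rightarrow> 'a) \<Rightarrow> ('a point \<Rightarrow> 'a) \<Rightarrow> 'a point \<Rightarrow> 'a point"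
  where "tri_ext m h f u = (\<lambda>a \<in> points (Suc m). let b = restrict a {1..m} in
    (h b)(Suc m := f b + a (Suc m) * u b))"

lemma tri_ext_upd:
  "a \<in> points m \<Longrightarrow> tri_ext m h f u (a(Suc m := c)) = (h a)(Suc m := f a + c * u a)"
  by (simp add: tri_ext_def Let_def points_upd restrict_points del: One_nat_def)

lemma points_Suc_E:
  assumes "a \<in> points (Suc m)"
  obtains b c where "b \<in> points m" "a = b(Suc m := c)"
  using upd_restrict_points[OF assms] points_restrict by metis

lemma tri_ext_ext: "tri_ext m h f u \<in> extensional (points (Suc m))"
  by (simp add: tri_ext_def)

lemma tri_ext_eqI:
  assumes "g \<in> extensional (points (Suc m))"
    and "\<And>a c. a \<in> points m \<Longrightarrow> g (a(Suc m := c)) = (h a)(Suc m := f a + c * u a)"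
  shows "g = tri_ext m h f u"
  by (rule extensionalityI[OF assms(1) tri_ext_ext])
    (metis assms(2) points_Suc_E tri_ext_upd)

text \<open>The values at \<open>c = 0\<close> and \<open>c = 1\<close> give \<open>f\<close> and
  then \<open>u\<close>. For \<open>h\<close>, the update at \<open>Suc m\<close> is undone by
  restriction, which works since \<open>h a\<close> and \<open>h' a\<close> lie in
  \<open>points m\<close>.\<close>

lemma tri_ext_inject:
  assumes eq: "tri_ext m h f u = tri_ext m h' f' u'"
    and h: "h \<in> points m \<rightarrow>\<^sub>E points m" "h' \<in> points m \<rightarrow>\<^sub>E points m"
    and ext: "f \<in> extensional (points m)" "f' \<in> extensional (points m)"
      "u \<in> extensional (points m)" "u' \<in> extensional (points m)"
  shows "h = h' \<and> f = f' \<and> u = u'"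
proof -
  have *: "(h a)(Suc m := f a + c * u a) = (h' a)(Suc m := f' a + c * u' a)"
    if "a \<in> points m" for a c
    using that eq by (metis tri_ext_upd)
  have f: "f a = f' a" if "a \<in> points m" for a
    using fun_cong[OF *[OF that, of 0], of "Suc m"] by simp
  have u: "u a = u' a" if "a \<in> points m" for a
    using fun_cong[OF *[OF that, of 1], of "Suc m"] f[OF that] by simp
  have "h a = h' a" if a: "a \<in> points m" for a
  proof -
    have "h a \<in> points m" "h' a \<in> points m"
      using h a by auto
    then show ?thesis
      using *[OF a] by (metis restrict_upd_points)
  qed
  with f u show ?thesis
    using h ext by (auto intro!: extensionalityI[of _ "points m"] simp: PiE_def)
qed

text \<open>The last coordinate \<open>f' a + c * u' a\<close> of the inner map is put into the
  outer one and the coefficient of \<open>c\<close> is collected. The outer \<open>f\<close> and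
  \<open>u\<close> are read at \<open>h' a\<close>; this twist disappears when \<open>h'\<close> is
  the identity.\<close>

lemma tri_ext_compose:
  fixes h' :: "'a::comm_ring_1 point \<Rightarrow> 'a point"
  assumes "h' \<in> points m \<rightarrow>\<^sub>E points m"
  shows "compose (points (Suc m)) (tri_ext m h f u) (tri_ext m h' f' u') =
    tri_ext m (compose (points m) h h') (\<lambda>a \<in> points m. f (h' a) + u (h' a) * f' a)
      (\<lambda>a \<in> points m. u (h' a) * u' a)"
proof (rule tri_ext_eqI)
  fix a :: "'a point" and c assume a: "a \<in> points m"
  then have "h' a \<in> points m"
    using assms by auto
  with a show "compose (points (Suc m)) (tri_ext m h f u) (tri_ext m h' f' u') (a(Suc m := c)) =
      (compose (points m) h h' a)(Suc m := (\<lambda>a \<in> points m. f (h' a) + u (h' a) * f' a) a +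
        c * (\<lambda>a \<in> points m. u (h' a) * u' a) a)"
    by (simp add: compose_eq points_upd tri_ext_upd algebra_simps)
qed (simp add: compose_def)

lemma tri_ext_id:
  "tri_ext m (\<lambda>a \<in> points m. a) (\<lambda>a \<in> points m. 0) (\<lambda>a \<in> points m. 1) =
    (\<lambda>a \<in> points (Suc m). a)"
  by (rule tri_ext_eqI[symmetric]) (simp_all add: points_upd)

text \<open>Equal images have equal first \<open>m\<close> coordinates, so injectivity of
  \<open>h\<close> gives equal base points, and the unit \<open>u a\<close> cancels in the last
  coordinate. Surjectivity then follows because \<open>points (Suc m)\<close> is finite.\<close>

lemma tri_ext_Bij:
  fixes h :: "'a::{finite,comm_ring_1} point \<Rightarrow> 'a point"
  assumes h: "h \<in> Bij (points m)" and u: "u \<in> unitfuns m"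
  shows "tri_ext m h f u \<in> Bij (points (Suc m))"
proof -
  have hp: "h a \<in> points m" if "a \<in> points m" for a
    using Bij_imp_funcset[OF h] that by auto
  have "inj_on (tri_ext m h f u) (points (Suc m))"
  proof (rule inj_onI)
    fix x y assume xy: "x \<in> points (Suc m)" "y \<in> points (Suc m)"
      and eq: "tri_ext m h f u x = tri_ext m h f u y"
    obtain a c where a: "a \<in> points m" "x = a(Suc m := c)" using xy(1) by (rule points_Suc_E)
    obtain b d where b: "b \<in> points m" "y = b(Suc m := d)" using xy(2) by (rule points_Suc_E)
    have *: "(h a)(Suc m := f a + c * u a) = (h b)(Suc m := f b + d * u b)"
      using eq a b by (simp add: tri_ext_upd)
    then have "h a = h b"
      using hp a(1) b(1) by (metis restrict_upd_points)
    then have "a = b"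
      using h a(1) b(1) by (auto simp: Bij_def bij_betw_def inj_on_def)
    moreover have "c = d"
    proof -
      have "c * u a = d * u a"
        using fun_cong[OF *, of "Suc m"] \<open>a = b\<close> by simp
      moreover have "u a dvd 1"
        using u a(1) by (simp add: unitfuns_iff)
      then obtain v where "1 = u a * v" by (rule dvdE)
      ultimately show ?thesis by (metis mult.assoc mult_1_right)
    qed
    ultimately show "x = y" using a b by simp
  qed
  moreover have "tri_ext m h f u ` points (Suc m) \<subseteq> points (Suc m)"
    by (auto elim!: points_Suc_E simp: tri_ext_upd hp points_upd)
  then have "tri_ext m h f u ` points (Suc m) = points (Suc m)"
    using calculation by (intro endo_inj_surj finite_points)
  ultimately show ?thesis
    by (simp add: Bij_def tri_ext_ext bij_betw_def)
qed

section \<open>Triangular tuples and the maps they induce\<close>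

abbreviation tri_group :: "nat \<Rightarrow> ('a::comm_ring_1 point \<Rightarrow> 'a point) monoid" where
  "tri_group m \<equiv> induced_group m (Mtri m)"

lemma carrier_induced_group: "carrier (induced_group m M) = tuple_fun m ` carrier M"
  by (simp add: induced_group_def)

lemma one_induced_group: "\<one>\<^bsub>induced_group m M\<^esub> = (\<lambda>a \<in> points m. a)"
  by (simp add: induced_group_def BijGroup_def)

text \<open>Bijectivity matters here: the product of \<open>BijGroup\<close> is restricted to
  \<open>Bij (points m)\<close> and is composition only there.\<close>

lemma mult_induced_group:
  "g \<in> Bij (points m) \<Longrightarrow> h \<in> Bij (points m) \<Longrightarrow>
     g \<otimes>\<^bsub>induced_group m M\<^esub> h = compose (points m) g h"
  by (simp add: induced_group_def BijGroup_def)

lemma carrier_Mtri: "F \<in> carrier (Mtri m) \<longleftrightarrow> F \<in> {1..m} \<rightarrow>\<^sub>E UNIV \<and>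
    F 1 \<in> polys 1 \<and> bij (\<lambda>a. evaluate (\<lambda>_. a) (F 1)) \<and>
    (\<forall>i \<in> {2..m}. \<exists>f \<in> polys (i - 1). \<exists>u \<in> unit_valued (i - 1). F i = f + Var i * u)"
  by (simp add: Mtri_def)

text \<open>Entries are peeled off from the end. The case \<open>m = 0\<close> is excluded because
  entry 1 has another shape than the later ones.\<close>

lemma carrier_Mtri_Suc:
  assumes "m \<ge> 1"
  shows "F \<in> carrier (Mtri (Suc m)) \<longleftrightarrow> F \<in> {1..Suc m} \<rightarrow>\<^sub>E UNIV \<and>
    restrict F {1..m} \<in> carrier (Mtri m) \<and>
    (\<exists>f \<in> polys m. \<exists>u \<in> unit_valued m. F (Suc m) = f + Var (Suc m) * u)"
proof -
  have "{2..Suc m} = insert (Suc m) {2..m}"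
    using assms by auto
  then show ?thesis
    using assms by (auto simp: carrier_Mtri)
qed

lemma Mtri_polys:
  assumes "F \<in> carrier (Mtri m)" "i \<in> {1..m}"
  shows "F i \<in> polys m"
proof (cases "i = 1")
  case True
  then show ?thesis
    using assms by (auto simp: carrier_Mtri intro: polys_mono[of 1])
next
  case False
  then obtain f u where "f \<in> polys (i - 1)" "u \<in> unit_valued (i - 1)" "F i = f + Var i * u"
    using assms by (fastforce simp: carrier_Mtri)
  with assms(2) show ?thesis
    by (auto intro!: polys_add polys_mult polys_Var intro: polys_mono[of "i - 1"] simp: unit_valued_def)
qed

lemma tri_group_PiE:
  assumes "h \<in> carrier (tri_group m)"
  shows "h \<in> points m \<rightarrow>\<^sub>E points m"
proof -
  obtain F where "h = tuple_fun m F"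
    using assms by (auto simp: carrier_induced_group)
  then show ?thesis
    unfolding tuple_fun_def by (auto simp: points_def simp del: One_nat_def intro!: restrict_PiE)
qed

text \<open>Each coordinate of an induced map comes from an entry of the tuple, a polynomial in the
  first \<open>m\<close> variables. This supplies the condition on coordinates in
  \<open>polyfuns_comp\<close>.\<close>

lemma tri_group_polyfuns:
  assumes "h \<in> carrier (tri_group m)" "i \<in> {1..m}"
  shows "(\<lambda>a \<in> points m. h a i) \<in> polyfuns m"
proof -
  obtain F where "F \<in> carrier (Mtri m)" "h = tuple_fun m F"
    using assms(1) by (auto simp: carrier_induced_group)
  with assms(2) show ?thesis
    by (intro polyfuns_I[of "F i"] restrict_ext) (auto simp: tuple_fun_def intro: Mtri_polys)
qed

text \<open>The bridge from tuples to \<open>tri_ext\<close>: the earlier entries, \<open>f\<close>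
  and \<open>u\<close> do not involve the variable \<open>Suc m\<close>, so their values at
  \<open>a(Suc m := c)\<close> are those at \<open>a\<close>.\<close>

lemma tuple_fun_Suc:
  assumes "\<And>i. i \<in> {1..m} \<Longrightarrow> F i \<in> polys m" "f \<in> polys m" "u \<in> polys m"
    and "F (Suc m) = f + Var (Suc m) * u"
  shows "tuple_fun (Suc m) F = tri_ext m (tuple_fun m (restrict F {1..m}))
    (\<lambda>a \<in> points m. evaluate a f) (\<lambda>a \<in> points m. evaluate a u)"
proof (rule tri_ext_eqI)
  fix a :: "'a point" and c assume a: "a \<in> points m"
  have ev: "evaluate (a(Suc m := c)) p = evaluate a p" if "p \<in> polys m" for p
    using that by (rule evaluate_cong) auto
  show "tuple_fun (Suc m) F (a(Suc m := c)) =
      (tuple_fun m (restrict F {1..m}) a)(Suc m := (\<lambda>a \<in> points m. evaluate a f) a +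
        c * (\<lambda>a \<in> points m. evaluate a u) a)"
    using a assms by (auto simp: tuple_fun_def points_upd ev fun_eq_iff)
qed (simp add: tuple_fun_def)

text \<open>Truncating a tuple yields \<open>h\<close>, and its last entry yields \<open>f\<close>
  and \<open>u\<close>. Conversely, representing polynomials are chosen and
  \<open>f + Var (Suc m) * u\<close> is appended as a new entry. The group arguments can then work
  with functions instead of tuples.\<close>

lemma carrier_tri_group_Suc:
  assumes "m \<ge> 1"
  shows "carrier (tri_group (Suc m) :: ('a::{finite,comm_ring_1} point \<Rightarrow> 'a point) monoid) =
    {tri_ext m h f u |h f u. h \<in> carrier (tri_group m) \<and> f \<in> polyfuns m \<and> u \<in> unitfuns m}"
    (is "_ = ?E")
proof (intro subset_antisym subsetI)
  fix g :: "'a point \<Rightarrow> 'a point"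
  assume "g \<in> carrier (tri_group (Suc m))"
  then obtain F where F: "F \<in> carrier (Mtri (Suc m))" "g = tuple_fun (Suc m) F"
    by (auto simp: carrier_induced_group)
  then obtain f u where fu: "restrict F {1..m} \<in> carrier (Mtri m)" "f \<in> polys m"
      "u \<in> unit_valued m" "F (Suc m) = f + Var (Suc m) * u"
    using carrier_Mtri_Suc[OF assms, of F] by blast
  have "F i \<in> polys m" if "i \<in> {1..m}" for i
    using Mtri_polys[OF fu(1) that] that by simp
  then have "g = tri_ext m (tuple_fun m (restrict F {1..m}))
      (\<lambda>a \<in> points m. evaluate a f) (\<lambda>a \<in> points m. evaluate a u)"
    unfolding F(2) using fu by (intro tuple_fun_Suc) (auto simp: unit_valued_def)
  with fu show "g \<in> ?E"
    by (auto simp: carrier_induced_group unitfuns_eq carrier_polyfun_ring)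
next
  fix g :: "'a point \<Rightarrow> 'a point"
  assume "g \<in> ?E"
  then obtain F f u where F: "F \<in> carrier (Mtri m)" and fu: "f \<in> polys m" "u \<in> unit_valued m"
    and g: "g = tri_ext m (tuple_fun m F)
      (\<lambda>a \<in> points m. evaluate a f) (\<lambda>a \<in> points m. evaluate a u)"
    by (auto simp: carrier_induced_group unitfuns_eq carrier_polyfun_ring)
  define G where "G = F(Suc m := f + Var (Suc m) * u)"
  have "F \<in> extensional {1..m}"
    using F by (simp add: carrier_Mtri PiE_def)
  then have GF: "restrict G {1..m} = F"
    by (auto simp: G_def extensional_def restrict_def)
  have "G i \<in> polys m" if "i \<in> {1..m}" for i
    using Mtri_polys[OF F that] that by (simp add: G_def)
  then have "tuple_fun (Suc m) G = tri_ext m (tuple_fun m (restrict G {1..m}))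
      (\<lambda>a \<in> points m. evaluate a f) (\<lambda>a \<in> points m. evaluate a u)"
    using fu by (intro tuple_fun_Suc) (auto simp: unit_valued_def G_def)
  then have "tuple_fun (Suc m) G = g"
    by (simp only: g GF)
  moreover have "G \<in> carrier (Mtri (Suc m))"
    unfolding carrier_Mtri_Suc[OF assms] GF using F fu
    by (auto simp: G_def carrier_Mtri PiE_def extensional_def)
  ultimately show "g \<in> carrier (tri_group (Suc m))"
    by (auto simp: carrier_induced_group)
qed

lemma id_Mtri: "(\<lambda>i \<in> {1..m}. Var i) \<in> carrier (Mtri m)" if "m \<ge> 1"
proof -
  have "\<exists>f \<in> polys (i - 1). \<exists>u \<in> unit_valued (i - 1). Var i = f + Var i * u" for i
    by (intro bexI[of _ 0] bexI[of _ 1]) (auto simp: unit_valued_def)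
  then show ?thesis
    using that by (auto simp: carrier_Mtri polys_Var o_def bij_def)
qed

lemma tuple_fun_id: "tuple_fun m (\<lambda>i \<in> {1..m}. Var i) = (\<lambda>a \<in> points m. a)"
  by (auto simp: tuple_fun_def points_def PiE_def extensional_def intro!: restrict_ext)

lemma one_tri_group: "m \<ge> 1 \<Longrightarrow> (\<lambda>a \<in> points m. a) \<in> carrier (tri_group m)"
  unfolding carrier_induced_group by (metis id_Mtri image_eqI tuple_fun_id)

text \<open>These are the triangular maps that leave the first \<open>m\<close> coordinates of every
  point unchanged, hence the kernel of forgetting the last coordinate.\<close>

lemma carrier_lin_group:
  assumes "m \<ge> 1"
  shows "carrier (induced_group (Suc m) (Mlin (Suc m) (Suc m)
      :: 'a::{finite,comm_ring_1} tuple monoid)) =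
    {tri_ext m (\<lambda>a \<in> points m. a) f u |f u. f \<in> polyfuns m \<and> u \<in> unitfuns m}" (is "_ = ?E")
proof (intro subset_antisym subsetI)
  fix g :: "'a point \<Rightarrow> 'a point"
  assume "g \<in> carrier (induced_group (Suc m) (Mlin (Suc m) (Suc m)))"
  then obtain F where FM: "F \<in> carrier (Mlin (Suc m) (Suc m))" and g: "g = tuple_fun (Suc m) F"
    unfolding carrier_induced_group by (rule imageE)
  have F: "F i = Var i" if "i \<in> {1..m}" for i
    using FM that by (simp add: Mlin_def)
  obtain f u where fu: "f \<in> polys m" "u \<in> unit_valued m" "F (Suc m) = f + Var (Suc m) * u"
    using FM by (auto simp: Mlin_def)
  have "restrict F {1..m} = (\<lambda>i \<in> {1..m}. Var i)"
    using F by (intro restrict_ext) auto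
  moreover have "F i \<in> polys m" if "i \<in> {1..m}" for i
    using F[OF that] that by (simp add: polys_Var)
  ultimately have "g = tri_ext m (\<lambda>a \<in> points m. a)
      (\<lambda>a \<in> points m. evaluate a f) (\<lambda>a \<in> points m. evaluate a u)"
    using tuple_fun_Suc[of m F f u] g fu by (simp add: unit_valued_def tuple_fun_id del: One_nat_def)
  with fu show "g \<in> ?E"
    by (auto simp: unitfuns_eq carrier_polyfun_ring)
next
  fix g :: "'a point \<Rightarrow> 'a point"
  assume "g \<in> ?E"
  then obtain f u where fu: "f \<in> polys m" "u \<in> unit_valued m"
    and g: "g = tri_ext m (\<lambda>a \<in> points m. a)
      (\<lambda>a \<in> points m. evaluate a f) (\<lambda>a \<in> points m. evaluate a u)"
    by (auto simp: unitfuns_eq carrier_polyfun_ring)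
  define G where "G = (\<lambda>i \<in> {1..m}. Var i)(Suc m := f + Var (Suc m) * u)"
  have GF: "restrict G {1..m} = (\<lambda>i \<in> {1..m}. Var i)"
    by (intro restrict_ext) (auto simp: G_def)
  have "G i \<in> polys m" if "i \<in> {1..m}" for i
    using that by (simp add: G_def polys_Var)
  then have "tuple_fun (Suc m) G = tri_ext m (tuple_fun m (restrict G {1..m}))
      (\<lambda>a \<in> points m. evaluate a f) (\<lambda>a \<in> points m. evaluate a u)"
    using fu by (intro tuple_fun_Suc) (auto simp: unit_valued_def G_def)
  then have "tuple_fun (Suc m) G = g"
    by (simp only: g GF tuple_fun_id)
  moreover have "G \<in> carrier (Mtri (Suc m))"
    unfolding carrier_Mtri_Suc[OF assms] GF using id_Mtri[OF assms] fu
    by (auto simp: G_def PiE_def extensional_def)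
  then have "G \<in> carrier (Mlin (Suc m) (Suc m))"
    using fu by (auto simp: Mlin_def G_def)
  ultimately show "g \<in> carrier (induced_group (Suc m) (Mlin (Suc m) (Suc m)))"
    by (auto simp: carrier_induced_group)
qed


section \<open>The iterated semidirect product\<close>

lemma evaluate_const_point: "\<exists>r. \<forall>c. evaluate (\<lambda>_. c) p = poly r c"
proof
  \<comment> \<open>Setting all variables equal to \<open>c\<close> turns a monomial into the power
    of \<open>c\<close> given by its total degree.\<close>
  let ?r = "\<Sum>e \<in> Poly_Mapping.keys p.
    monom (Poly_Mapping.lookup p e) (\<Sum>i \<in> Poly_Mapping.keys e. Poly_Mapping.lookup e i)"
  show "\<forall>c. evaluate (\<lambda>_. c) p = poly ?r c"
    by (simp add: evaluate_def' monomial_value_def poly_sum poly_monom power_sum)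
qed

text \<open>With \<open>evaluate_const_point\<close> this reconciles the two encodings of
  polynomials: \<open>Mtri\<close> uses multivariate ones for its first entry,
  \<open>polyperm_group\<close> univariate ones.\<close>

lemma poly_eq_evaluate: "\<exists>p \<in> polys 1. \<forall>c. poly r c = evaluate (\<lambda>_. c) p"
proof
  let ?p = "\<Sum>i \<le> degree r. Const (coeff r i) * Var 1 ^ i"
  show "?p \<in> polys 1"
    by (intro polys_sum polys_mult polys_power polys_Const polys_Var) auto
  show "\<forall>c. poly r c = evaluate (\<lambda>_. c) ?p"
    by (simp add: poly_altdef evaluate_sum evaluate_power)
qed

lemma carrier_polyperm_group: "carrier polyperm_group = {q. bij q \<and> q \<in> range poly}"
  by (auto simp: polyperm_group_def Bij_def extensional_def)

lemma mult_polyperm_group: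
  "p \<in> carrier polyperm_group \<Longrightarrow> q \<in> carrier polyperm_group \<Longrightarrow> p \<otimes>\<^bsub>polyperm_group\<^esub> q = p \<circ> q"
  by (auto simp: polyperm_group_def BijGroup_def compose_def)

lemma polyperm_group_comp:
  fixes p q :: "'a::comm_ring_1 \<Rightarrow> 'a"
  shows "p \<in> carrier polyperm_group \<Longrightarrow> q \<in> carrier polyperm_group \<Longrightarrow> p \<circ> q \<in> carrier polyperm_group"
proof -
  assume pq: "p \<in> carrier polyperm_group" "q \<in> carrier polyperm_group"
  then obtain f g where fg: "p = poly f" "q = poly g"
    by (auto simp: carrier_polyperm_group)
  have "p \<circ> q = poly (pcompose f g)"
    by (simp add: fg fun_eq_iff poly_pcompose)
  then have "p \<circ> q \<in> range poly"
    by simp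
  with pq show "p \<circ> q \<in> carrier polyperm_group"
    by (simp add: carrier_polyperm_group bij_comp)
qed

lemma group_polyperm_group:
  "group (polyperm_group :: ('a::{finite,comm_ring_1} \<Rightarrow> 'a) monoid)"
  unfolding polyperm_group_def
proof (rule group_finite_maps)
  have "(\<lambda>x \<in> UNIV. x) = poly [:0, 1 :: 'a:]"
    by (simp add: fun_eq_iff)
  then show "(\<lambda>x \<in> UNIV. x :: 'a) \<in> Bij UNIV \<inter> range poly"
    using id_Bij by (metis IntI rangeI)
  fix g h :: "'a \<Rightarrow> 'a"
  assume gh: "g \<in> Bij UNIV \<inter> range poly" "h \<in> Bij UNIV \<inter> range poly"
  then have "g \<in> carrier polyperm_group" "h \<in> carrier polyperm_group"
    by (simp_all add: polyperm_group_def)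
  then have "g \<circ> h \<in> carrier polyperm_group"
    by (rule polyperm_group_comp)
  then show "compose UNIV g h \<in> Bij UNIV \<inter> range poly"
    by (simp add: polyperm_group_def compose_def o_def restrict_UNIV)
qed auto

text \<open>Transfers a map of \<open>R\<close> to \<open>R^1\<close>, whose points are extensional
  functions on \<open>{1}\<close> and not ring elements. It serves as the isomorphism from
  \<open>polyperm_group\<close> to \<open>tri_group 1\<close>.\<close>

definition single_point_map :: "('a \<Rightarrow> 'a) \<Rightarrow> 'a point \<Rightarrow> 'a point" where
  "single_point_map q = (\<lambda>a \<in> points 1. \<lambda>i \<in> {1..1}. q (a 1))"

lemma single_point_map_const:
  "(\<lambda>i \<in> {1..1}. c) \<in> points 1"
  "single_point_map q (\<lambda>i \<in> {1..1}. c) = (\<lambda>i \<in> {1..1}. q c)"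
  by (auto simp: single_point_map_def points_def)

lemma points_1_eq: "a \<in> points 1 \<Longrightarrow> a = (\<lambda>i \<in> {1..1}. a 1)"
  by (auto simp: points_def PiE_def extensional_def)

lemma inj_single_point_map: "inj single_point_map"
proof (rule injI, rule ext)
  fix p q :: "'a \<Rightarrow> 'a" and c
  assume eq: "single_point_map p = single_point_map q"
  have "(\<lambda>i \<in> {1..1 :: nat}. p c) = (\<lambda>i \<in> {1..1}. q c)"
    using arg_cong[OF eq, of "\<lambda>g. g (\<lambda>i \<in> {1..1}. c)"] by (simp only: single_point_map_const)
  from fun_cong[OF this, of 1] show "p c = q c"
    by (simp only: restrict_apply atLeastAtMost_singleton singletonI if_True)
qed

lemma single_point_map_comp:
  "single_point_map (p \<circ> q) = compose (points 1) (single_point_map p) (single_point_map q)"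
  unfolding compose_def
  by (subst single_point_map_def, rule restrict_ext) (auto simp: single_point_map_def points_def)

lemma single_point_map_Bij:
  fixes q :: "'a::finite \<Rightarrow> 'a"
  assumes "bij q"
  shows "single_point_map q \<in> Bij (points 1)"
proof -
  let ?S = "points 1 :: 'a point set"
  have "inj_on (single_point_map q) ?S"
  proof (rule inj_onI)
    fix a b :: "'a point"
    assume ab: "a \<in> points 1" "b \<in> points 1" "single_point_map q a = single_point_map q b"
    have "q (a 1) = q (b 1)"
      using fun_cong[OF ab(3), of 1] ab(1,2) by (simp add: single_point_map_def del: One_nat_def)
    then have "a 1 = b 1"
      using injD[OF bij_is_inj[OF assms]] by blast
    then show "a = b"
      by (subst points_1_eq[OF ab(1)], subst points_1_eq[OF ab(2)]) simp
  qed
  moreover have "single_point_map q ` ?S \<subseteq> ?S"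
    by (rule image_subsetI) (simp add: single_point_map_def points_def)
  then have "single_point_map q ` ?S = ?S"
    using calculation by (intro endo_inj_surj finite_points)
  ultimately show ?thesis
    by (simp add: Bij_def bij_betw_def) (simp add: single_point_map_def)
qed

text \<open>\<open>Mtri\<close> evaluates its first entry at a constant point,
  \<open>tuple_fun\<close> at an extensional point of \<open>R^1\<close>. Both give the same value
  because only the variable with index 1 occurs in \<open>F 1\<close>.\<close>

lemma tuple_fun_1:
  assumes "F 1 \<in> polys 1"
  shows "tuple_fun 1 F = single_point_map (\<lambda>c. evaluate (\<lambda>_. c) (F 1))"
  unfolding tuple_fun_def single_point_map_def
  by (intro restrict_ext) (use assms in \<open>auto intro: evaluate_cong\<close>)

lemma carrier_tri_group_1: "carrier (tri_group 1) = single_point_map ` carrier polyperm_group"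
proof (intro subset_antisym subsetI)
  fix g :: "'a point \<Rightarrow> 'a point"
  assume "g \<in> carrier (tri_group 1)"
  then obtain F where FM: "F \<in> carrier (Mtri 1)" and g: "g = tuple_fun 1 F"
    unfolding carrier_induced_group by (rule imageE)
  have F: "F 1 \<in> polys 1" "bij (\<lambda>c. evaluate (\<lambda>_. c) (F 1))"
    using FM by (auto simp: carrier_Mtri)
  obtain r where "\<And>c. evaluate (\<lambda>_. c) (F 1) = poly r c"
    using evaluate_const_point by metis
  then have "(\<lambda>c. evaluate (\<lambda>_. c) (F 1)) = poly r" by (intro ext)
  with F(2) show "g \<in> single_point_map ` carrier polyperm_group"
    unfolding g tuple_fun_1[of F, OF F(1)] by (auto simp: carrier_polyperm_group)
next
  fix g :: "'a point \<Rightarrow> 'a point"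
  assume "g \<in> single_point_map ` carrier polyperm_group"
  then obtain r where r: "bij (poly r)" "g = single_point_map (poly r)"
    by (auto simp: carrier_polyperm_group)
  obtain p where p: "p \<in> polys 1" "\<And>c. poly r c = evaluate (\<lambda>_. c) p"
    using poly_eq_evaluate by metis
  then have eq: "poly r = (\<lambda>c. evaluate (\<lambda>_. c) p)" by (intro ext)
  let ?F = "\<lambda>i \<in> {1..1::nat}. p"
  have "?F \<in> carrier (Mtri 1)"
    using p(1) r(1) by (simp add: carrier_Mtri eq)
  moreover have "g = tuple_fun 1 ?F"
    using p(1) by (subst tuple_fun_1) (simp_all add: r(2) eq)
  ultimately show "g \<in> carrier (tri_group 1)"
    unfolding carrier_induced_group by blast
qed

section \<open>Closure under composition and the group structure\<close>

lemma tri_ext_mem: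
  fixes f u :: "'a::{finite,comm_ring_1} point \<Rightarrow> 'a"
  assumes "m \<ge> 1" "h \<in> carrier (tri_group m)" "f \<in> polyfuns m" "u \<in> unitfuns m"
  shows "tri_ext m h f u \<in> carrier (tri_group (Suc m))"
  using assms by (auto simp: carrier_tri_group_Suc)

text \<open>Induction on \<open>m\<close> through the description by triples: closure follows from
  the formula in \<open>tri_ext_compose\<close>, bijectivity from \<open>tri_ext_Bij\<close>. In the
  base case both are inherited from the polynomial permutations of \<open>R\<close>.\<close>

lemma tri_group_closed:
  assumes "m \<ge> 1"
  shows "carrier (tri_group m :: ('a::{finite,comm_ring_1} point \<Rightarrow> 'a point) monoid) \<subseteq> Bij (points m) \<and>
    (\<forall>g \<in> carrier (tri_group m). \<forall>h \<in> carrier (tri_group m).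
       compose (points m) g h \<in> carrier (tri_group m :: ('a point \<Rightarrow> 'a point) monoid))"
  using assms
proof (induction m rule: nat_induct_at_least)
  case base
  show ?case
    unfolding carrier_tri_group_1
  proof (intro conjI subsetI ballI; elim imageE; hypsubst)
    fix p q :: "'a \<Rightarrow> 'a"
    assume q: "q \<in> carrier polyperm_group"
    show "single_point_map q \<in> Bij (points 1)"
      using q by (intro single_point_map_Bij) (simp add: carrier_polyperm_group)
    assume "p \<in> carrier polyperm_group"
    with q show "compose (points 1) (single_point_map p) (single_point_map q) \<in>
        single_point_map ` carrier polyperm_group"
      by (simp only: single_point_map_comp[symmetric] imageI polyperm_group_comp)
  qed
next
  case (Suc m)
  have "compose (points (Suc m)) g k \<in> carrier (tri_group (Suc m))"
    if gk: "g \<in> carrier (tri_group (Suc m))" "k \<in> carrier (tri_group (Suc m))"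
    for g k :: "'a point \<Rightarrow> 'a point"
  proof -
    obtain h f u where g: "g = tri_ext m h f u" "h \<in> carrier (tri_group m)"
        "f \<in> polyfuns m" "u \<in> unitfuns m"
      using gk(1) unfolding carrier_tri_group_Suc[OF Suc.hyps] by blast
    obtain h' f' u' where k: "k = tri_ext m h' f' u'" "h' \<in> carrier (tri_group m)"
        "f' \<in> polyfuns m" "u' \<in> unitfuns m"
      using gk(2) unfolding carrier_tri_group_Suc[OF Suc.hyps] by blast
    have h': "h' a \<in> points m" if "a \<in> points m" for a
      using tri_group_PiE[OF k(2)] that by auto
    \<comment> \<open>Pulling \<open>f\<close> or \<open>u\<close> back along \<open>h'\<close>
      gives a polynomial function again, since the coordinates of \<open>h'\<close> are polynomial
      functions.\<close>
    have comp: "(\<lambda>a \<in> points m. w (h' a)) \<in> polyfuns m" if "w \<in> polyfuns m" for w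
      using that tri_group_polyfuns[OF k(2)] h' by (rule polyfuns_comp)
    have "(\<lambda>a \<in> points m. f (h' a) + u (h' a) * f' a) \<in> polyfuns m"
      using polyfuns_add[OF comp[OF g(3)] polyfuns_mult[OF comp k(3)], of u] g(4)
      by (simp add: unitfuns_iff cong: restrict_cong)
    moreover have "(\<lambda>a \<in> points m. u (h' a) * u' a) \<in> unitfuns m"
    proof -
      have "u (h' a) * u' a dvd 1" if "a \<in> points m" for a
        using g(4) k(4) h'[OF that] that mult_dvd_mono[of "u (h' a)" 1 "u' a" 1]
        by (simp add: unitfuns_iff)
      then show ?thesis
        using polyfuns_mult[OF comp, of u u'] g(4) k(4)
        by (simp add: unitfuns_iff cong: restrict_cong)
    qed
    moreover have "compose (points m) h h' \<in> carrier (tri_group m)"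
      using bspec[OF bspec[OF conjunct2[OF Suc.IH] g(2)] k(2)] by simp
    ultimately show ?thesis
      unfolding g(1) k(1) tri_ext_compose[OF tri_group_PiE[OF k(2)]]
      using Suc.hyps by (intro tri_ext_mem)
  qed
  moreover have "carrier (tri_group (Suc m) :: ('a point \<Rightarrow> 'a point) monoid) \<subseteq> Bij (points (Suc m))"
  proof
    fix g :: "'a point \<Rightarrow> 'a point" assume "g \<in> carrier (tri_group (Suc m))"
    then obtain h f u where g: "g = tri_ext m h f u" "h \<in> carrier (tri_group m)" "u \<in> unitfuns m"
      unfolding carrier_tri_group_Suc[OF Suc.hyps] by blast
    from g(2) have "h \<in> Bij (points m)"
      using conjunct1[OF Suc.IH] by (rule rev_subsetD)
    with g show "g \<in> Bij (points (Suc m))"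
      by (simp add: tri_ext_Bij)
  qed
  ultimately show ?case
    by (intro conjI ballI)
qed

lemma tri_group_Bij:
  fixes g :: "'a::{finite,comm_ring_1} point \<Rightarrow> 'a point"
  shows "m \<ge> 1 \<Longrightarrow> g \<in> carrier (tri_group m) \<Longrightarrow> g \<in> Bij (points m)"
  using tri_group_closed by blast

lemma finite_Bij_points: "finite (Bij (points m :: 'a::finite point set))"
proof (rule finite_subset)
  show "Bij (points m :: 'a point set) \<subseteq> points m \<rightarrow>\<^sub>E points m"
    by (auto simp: PiE_def dest: Bij_imp_funcset Bij_imp_extensional)
qed (simp add: finite_PiE finite_points)

lemma group_tri_group:
  assumes "m \<ge> 1"
  shows "group (tri_group m :: ('a::{finite,comm_ring_1} point \<Rightarrow> 'a point) monoid)"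
  unfolding induced_group_def
proof (rule group_finite_maps)
  show "(\<lambda>a \<in> points m. a) \<in> tuple_fun m ` carrier (Mtri m :: 'a tuple monoid)"
    using one_tri_group[OF assms] by (simp add: carrier_induced_group)
  show "tuple_fun m ` carrier (Mtri m :: 'a tuple monoid) \<subseteq> Bij (points m)"
    using tri_group_closed[OF assms] by (auto simp: carrier_induced_group)
  then show "finite (tuple_fun m ` carrier (Mtri m :: 'a tuple monoid))"
    using finite_Bij_points finite_subset by blast
qed (use tri_group_closed[OF assms] in \<open>auto simp: carrier_induced_group\<close>)

lemma tri_group_1_iso:
  "(tri_group 1 :: ('a::{finite,comm_ring_1} point \<Rightarrow> 'a point) monoid) \<cong>
    (polyperm_group :: ('a \<Rightarrow> 'a) monoid)"
proof -
  let ?T = "tri_group 1 :: ('a point \<Rightarrow> 'a point) monoid"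
  have "single_point_map \<in> iso (polyperm_group :: ('a \<Rightarrow> 'a) monoid) ?T"
  proof (rule isoI)
    have "single_point_map (p \<otimes>\<^bsub>polyperm_group\<^esub> q) =
        single_point_map p \<otimes>\<^bsub>?T\<^esub> single_point_map q"
      if "p \<in> carrier polyperm_group" "q \<in> carrier polyperm_group" for p q :: "'a \<Rightarrow> 'a"
    proof -
      have "single_point_map p \<in> Bij (points 1)" "single_point_map q \<in> Bij (points 1)"
        using that by (simp_all add: carrier_polyperm_group single_point_map_Bij del: One_nat_def)
      with that show ?thesis
        by (simp only: mult_induced_group mult_polyperm_group single_point_map_comp)
    qed
    then show "single_point_map \<in> hom (polyperm_group :: ('a \<Rightarrow> 'a) monoid) ?T"
      by (intro homI) (simp_all only: carrier_tri_group_1 imageI)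
    show "bij_betw single_point_map (carrier (polyperm_group :: ('a \<Rightarrow> 'a) monoid)) (carrier ?T)"
      unfolding carrier_tri_group_1 by (meson inj_on_imp_bij_betw inj_on_subset inj_single_point_map subset_UNIV)
  qed
  then show ?thesis
    by (rule group.iso_sym[OF group_polyperm_group is_isoI])
qed

section \<open>Counting triangular maps\<close>

lemma tri_ext_inj_on:
  "inj_on (\<lambda>(h, f, u). tri_ext m h f u)
     (carrier (tri_group m) \<times> polyfuns m \<times> (unitfuns m :: ('a::{finite,comm_ring_1} point \<Rightarrow> 'a) set))"
proof (rule inj_onI, elim SigmaE, simp only: prod.case)
  fix h h' :: "'a point \<Rightarrow> 'a point" and f f' u u' :: "'a point \<Rightarrow> 'a"
  assume "h \<in> carrier (tri_group m)" "h' \<in> carrier (tri_group m)" "f \<in> polyfuns m" "f' \<in> polyfuns m"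
    "u \<in> unitfuns m" "u' \<in> unitfuns m" "tri_ext m h f u = tri_ext m h' f' u'"
  then show "(h, f, u) = (h', f', u')"
    using tri_ext_inject[of m h f u h' f' u'] by (simp add: unitfuns_iff polyfuns_ext tri_group_PiE)
qed

text \<open>Each triangular map comes from exactly one triple, so the triples are counted in its
  place.\<close>

lemma card_tri_group_Suc:
  assumes "m \<ge> 1"
  shows "card (carrier (tri_group (Suc m) :: ('a::{finite,comm_ring_1} point \<Rightarrow> 'a point) monoid)) =
    card (carrier (tri_group m :: ('a point \<Rightarrow> 'a point) monoid)) *
    (card (polyfuns m :: ('a point \<Rightarrow> 'a) set) * card (unitfuns m :: ('a point \<Rightarrow> 'a) set))"
proof -
  have "carrier (tri_group (Suc m) :: ('a point \<Rightarrow> 'a point) monoid) =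
      (\<lambda>(h, f, u). tri_ext m h f u) ` (carrier (tri_group m) \<times> polyfuns m \<times> unitfuns m)"
    unfolding carrier_tri_group_Suc[OF assms] by force
  then show ?thesis
    by (simp add: card_image tri_ext_inj_on card_cartesian_product)
qed

text \<open>The projection drops the last coordinate; the section extends a map by the identity there.\<close>

lemma semidirect_tri_group:
  fixes A :: "'b monoid"
  assumes "m \<ge> 1" and A: "group A" and i: "i \<in> mon A (tri_group (Suc m))"
    and ker: "i ` carrier A = {tri_ext m (\<lambda>a \<in> points m. a) f u |f u.
      f \<in> polyfuns m \<and> u \<in> (unitfuns m :: ('a::{finite,comm_ring_1} point \<Rightarrow> 'a) set)}"
  shows "semidirect A (tri_group (Suc m) :: ('a point \<Rightarrow> 'a point) monoid)
    (tri_group m :: ('a point \<Rightarrow> 'a point) monoid)"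
proof -
  let ?B = "tri_group (Suc m) :: ('a point \<Rightarrow> 'a point) monoid"
  let ?C = "tri_group m :: ('a point \<Rightarrow> 'a point) monoid"
  let ?zero = "\<lambda>a \<in> points m. 0 :: 'a" and ?one = "\<lambda>a \<in> points m. 1 :: 'a"
  \<comment> \<open>The value \<open>0\<close> for the last coordinate is an arbitrary choice: the
    first \<open>m\<close> coordinates of the image under a triangular map do not depend on
    it.\<close>
  define p :: "('a point \<Rightarrow> 'a point) \<Rightarrow> 'a point \<Rightarrow> 'a point"
    where "p = (\<lambda>g. \<lambda>a \<in> points m. restrict (g (a(Suc m := 0))) {1..m})"
  define s where "s = (\<lambda>h :: 'a point \<Rightarrow> 'a point. tri_ext m h ?zero ?one)"
  note B = carrier_tri_group_Suc[OF assms(1), where ?'a = 'a]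
  have zero: "?zero \<in> polyfuns m" by (rule polyfuns_const)
  have one: "?one \<in> unitfuns m" by (simp add: unitfuns_iff polyfuns_const)
  have p: "p (tri_ext m h f u) = h" if "h \<in> carrier ?C" for h f u
  proof (rule extensionalityI[of _ "points m"])
    show "h \<in> extensional (points m)"
      using tri_group_PiE[OF that] by (simp add: PiE_def)
    fix a :: "'a point" assume a: "a \<in> points m"
    then have "h a \<in> points m"
      using tri_group_PiE[OF that] by auto
    with a show "p (tri_ext m h f u) a = h a"
      by (simp add: p_def tri_ext_upd restrict_points del: One_nat_def)
  qed (simp add: p_def)
  have multB: "g \<otimes>\<^bsub>?B\<^esub> k = compose (points (Suc m)) g k"
    if "g \<in> carrier ?B" "k \<in> carrier ?B" for g k
    using that by (intro mult_induced_group tri_group_Bij) auto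
  have multC: "g \<otimes>\<^bsub>?C\<^esub> k = compose (points m) g k"
    if "g \<in> carrier ?C" "k \<in> carrier ?C" for g k
    using that assms(1) by (intro mult_induced_group tri_group_Bij) auto
  have sB: "s h \<in> carrier ?B" if "h \<in> carrier ?C" for h
    using that zero one assms(1) by (auto simp: s_def intro: tri_ext_mem)
  have ps: "p (s h) = h" if "h \<in> carrier ?C" for h
    using p[OF that] by (simp add: s_def)
  have p_hom: "p \<in> hom ?B ?C"
  proof (rule homI)
    fix g k assume gk: "g \<in> carrier ?B" "k \<in> carrier ?B"
    then obtain h f u h' f' u' where *: "g = tri_ext m h f u" "h \<in> carrier ?C"
        "k = tri_ext m h' f' u'" "h' \<in> carrier ?C"
      unfolding B by blast
    show "p g \<in> carrier ?C"
      using * by (simp add: p)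
    have "compose (points m) h h' \<in> carrier ?C"
      using * tri_group_closed[OF assms(1)] by blast
    then show "p (g \<otimes>\<^bsub>?B\<^esub> k) = p g \<otimes>\<^bsub>?C\<^esub> p k"
      unfolding multB[OF gk] using * by (simp add: tri_ext_compose tri_group_PiE p multC)
  qed
  moreover have "p ` carrier ?B = carrier ?C"
    using p_hom sB ps by (force simp: hom_def)
  ultimately have "p \<in> epi ?B ?C"
    by (simp add: epi_def)
  \<comment> \<open>Since \<open>p\<close> returns the component \<open>h\<close>, the kernel
    consists of the triples with the identity as \<open>h\<close>, which is the set given in
    \<open>ker\<close>.\<close>
  moreover have "kernel ?B ?C p = i ` carrier A"
    unfolding ker kernel_def B one_induced_group
    using p one_tri_group[OF assms(1)] by fastforce
  moreover have "s \<in> hom ?C ?B"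
  proof (rule homI)
    fix g k assume gk: "g \<in> carrier ?C" "k \<in> carrier ?C"
    \<comment> \<open>\<open>?zero\<close> and \<open>?one\<close> have their values only on
      \<open>points m\<close>. With this, the composition formula yields \<open>0 + 1 * 0\<close>
      and \<open>1 * 1\<close>, so the composite is again of the form \<open>s h\<close>.\<close>
    have "k a \<in> points m" if "a \<in> points m" for a
      using tri_group_PiE[OF gk(2)] that by auto
    then have "compose (points (Suc m)) (s g) (s k) = s (compose (points m) g k)"
      unfolding s_def tri_ext_compose[OF tri_group_PiE[OF gk(2)]]
      by (intro arg_cong2[where f = "tri_ext m _"] restrict_ext) simp_all
    then show "s (g \<otimes>\<^bsub>?C\<^esub> k) = s g \<otimes>\<^bsub>?B\<^esub> s k"
      using gk by (simp add: multB multC sB)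
  qed (rule sB)
  ultimately show ?thesis
    unfolding semidirect_def using A i ps assms(1)
    by (intro conjI exI[of _ i] exI[of _ p] exI[of _ s] ballI group_tri_group) simp_all
qed

text \<open>With the identity as inner \<open>h'\<close> the twist is gone, and what remains is the
  multiplication of \<open>add_units_semidirect\<close>.\<close>

lemma tri_ext_id_compose:
  fixes f u f' u' :: "'a::comm_ring_1 point \<Rightarrow> 'a"
  shows "compose (points (Suc m)) (tri_ext m (\<lambda>a \<in> points m. a) f u)
      (tri_ext m (\<lambda>a \<in> points m. a) f' u') =
    tri_ext m (\<lambda>a \<in> points m. a) (f \<oplus>\<^bsub>polyfun_ring m\<^esub> u \<otimes>\<^bsub>polyfun_ring m\<^esub> f')
      (u \<otimes>\<^bsub>polyfun_ring m\<^esub> u')"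
proof -
  have id: "(\<lambda>a \<in> points m. a) \<in> points m \<rightarrow>\<^sub>E (points m :: 'a point set)"
    by auto
  have "compose (points m) (\<lambda>a \<in> points m. a) (\<lambda>a \<in> points m. a) = (\<lambda>a \<in> points m. a :: 'a point)"
    by (auto simp: compose_def)
  then show ?thesis
    unfolding tri_ext_compose[OF id] polyfun_ring_ops by (simp cong: restrict_cong)
qed

text \<open>Supplies the factor in the second decomposition: a pair \<open>(f, u)\<close> goes to
  the triple with the identity as \<open>h\<close>. This is a homomorphism by
  \<open>tri_ext_id_compose\<close> and injective by uniqueness of the triple.\<close>

lemma semidirect_units:
  assumes "m \<ge> 1"
  shows "semidirect (add_units_semidirect (polyfun_ring m :: ('a::{finite,comm_ring_1} point \<Rightarrow> 'a) ring))
    (tri_group (Suc m) :: ('a point \<Rightarrow> 'a point) monoid) (tri_group m :: ('a point \<Rightarrow> 'a point) monoid)"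
proof -
  let ?R = "polyfun_ring m :: ('a point \<Rightarrow> 'a) ring"
  let ?A = "add_units_semidirect ?R"
  let ?i = "\<lambda>(f, u). tri_ext m (\<lambda>a \<in> points m. a) f u"
  interpret cring ?R by (rule cring_polyfun_ring)
  \<comment> \<open>The split sequence for \<open>add_units_semidirect\<close> already contains the
    fact that its middle term is a group.\<close>
  have A: "group ?A"
    using semidirect_add_units[OF ring_axioms] by (simp add: semidirect_def)
  have mem: "tri_ext m (\<lambda>a \<in> points m. a) f u \<in> carrier (tri_group (Suc m))"
    if "f \<in> polyfuns m" "u \<in> unitfuns m" for f u :: "'a point \<Rightarrow> 'a"
    using that assms by (intro tri_ext_mem one_tri_group)
  have "?i \<in> mon ?A (tri_group (Suc m))"
    unfolding mon_def
  proof (intro CollectI conjI homI)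
    show "inj_on ?i (carrier ?A)"
    proof (rule inj_onI)
      fix x y assume xy: "x \<in> carrier ?A" "y \<in> carrier ?A" "?i x = ?i y"
      obtain f u f' u' where *: "x = (f, u)" "y = (f', u')" "f \<in> polyfuns m" "u \<in> unitfuns m"
          "f' \<in> polyfuns m" "u' \<in> unitfuns m"
        using xy(1,2) by (auto simp: add_units_semidirect_def)
      with xy(3) show "x = y"
        using inj_onD[OF tri_ext_inj_on[of m], of "(\<lambda>a \<in> points m. a, f, u)" "(\<lambda>a \<in> points m. a, f', u')"]
          one_tri_group[OF assms] by simp
    qed
  next
    fix x y assume xy: "x \<in> carrier ?A" "y \<in> carrier ?A"
    then obtain f u f' u' where *: "x = (f, u)" "y = (f', u')" "f \<in> polyfuns m" "u \<in> unitfuns m"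
        "f' \<in> polyfuns m" "u' \<in> unitfuns m"
      by (auto simp: add_units_semidirect_def)
    show "?i x \<in> carrier (tri_group (Suc m))"
      using * mem by simp
    show "?i (x \<otimes>\<^bsub>?A\<^esub> y) = ?i x \<otimes>\<^bsub>tri_group (Suc m)\<^esub> ?i y"
      using * mem
      by (simp add: mult_induced_group tri_group_Bij tri_ext_id_compose)
        (simp add: add_units_semidirect_def)
  qed
  moreover have "?i ` carrier ?A = {tri_ext m (\<lambda>a \<in> points m. a) f u |f u.
      f \<in> polyfuns m \<and> u \<in> unitfuns m}"
    by (force simp: add_units_semidirect_def)
  ultimately show ?thesis
    using assms A by (intro semidirect_tri_group)
qed

text \<open>Supplies the factor in the first decomposition: the kernel itself is taken as the normal
  factor, embedded by inclusion. It is a group because it is a finite set of bijections closed under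
  composition, by \<open>tri_ext_id_compose\<close>.\<close>

lemma semidirect_lin:
  assumes "m \<ge> 1"
  shows "semidirect (induced_group (Suc m) (Mlin (Suc m) (Suc m) :: 'a::{finite,comm_ring_1} tuple monoid))
    (tri_group (Suc m) :: ('a point \<Rightarrow> 'a point) monoid) (tri_group m :: ('a point \<Rightarrow> 'a point) monoid)"
proof -
  let ?A = "induced_group (Suc m) (Mlin (Suc m) (Suc m) :: 'a tuple monoid)"
  let ?S = "points (Suc m) :: 'a point set"
  interpret cring "polyfun_ring m :: ('a point \<Rightarrow> 'a) ring" by (rule cring_polyfun_ring)
  note carr = carrier_lin_group[OF assms, where ?'a = 'a]
  have sub: "carrier ?A \<subseteq> carrier (tri_group (Suc m))"
    unfolding carr using tri_ext_mem[OF assms one_tri_group[OF assms]] by auto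
  then have Bij: "carrier ?A \<subseteq> Bij ?S"
    by (auto intro: tri_group_Bij)
  have eq: "?A = BijGroup ?S \<lparr>carrier := carrier ?A\<rparr>"
    by (simp add: induced_group_def)
  have "group (BijGroup ?S \<lparr>carrier := carrier ?A\<rparr>)"
  proof (rule group_finite_maps)
    show "finite (carrier ?A)"
      using Bij finite_Bij_points finite_subset by blast
    show "(\<lambda>a \<in> ?S. a) \<in> carrier ?A"
      unfolding carr tri_ext_id[symmetric]
      using zero_closed Units_one_closed by (auto simp: polyfun_ring_ops)
    fix g h assume "g \<in> carrier ?A" "h \<in> carrier ?A"
    then obtain f u f' u' where gh: "g = tri_ext m (\<lambda>a \<in> points m. a) f u" "f \<in> polyfuns m" "u \<in> unitfuns m"
        "h = tri_ext m (\<lambda>a \<in> points m. a) f' u'" "f' \<in> polyfuns m" "u' \<in> unitfuns m"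
      unfolding carr by blast
    then have "f \<oplus>\<^bsub>polyfun_ring m\<^esub> u \<otimes>\<^bsub>polyfun_ring m\<^esub> f' \<in> polyfuns m"
        "u \<otimes>\<^bsub>polyfun_ring m\<^esub> u' \<in> unitfuns m"
      by (simp_all add: Units_closed)
    then show "compose ?S g h \<in> carrier ?A"
      unfolding carr gh(1,4) tri_ext_id_compose by blast
  qed (rule Bij)
  then have "group ?A"
    using eq by metis
  moreover have "(\<lambda>g. g) \<in> mon ?A (tri_group (Suc m))"
    using sub by (auto simp: mon_def hom_def induced_group_def)
  ultimately show ?thesis
    using assms carr by (intro semidirect_tri_group[where i = "\<lambda>g. g"]) auto
qed

section \<open>Induction on the number of variables\<close>

theorem theorem4p15:
  fixes n :: nat
  assumes "n > 1"
  shows "(iterated_semidirect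
           (map (\<lambda>k. induced_group k (Mlin k k :: 'a::{finite,comm_ring_1} tuple monoid))
             (rev [2..<Suc n]))
           (polyperm_group :: ('a \<Rightarrow> 'a) monoid)
           (induced_group n (Mtri n :: 'a tuple monoid))) \<and>
         (iterated_semidirect
           (map (\<lambda>i. add_units_semidirect (polyfun_ring i :: ('a point \<Rightarrow> 'a) ring))
             (rev [1..<n]))
           (polyperm_group :: ('a \<Rightarrow> 'a) monoid)
           (induced_group n (Mtri n :: 'a tuple monoid))) \<and>
         (card (carrier (induced_group n (Mtri n :: 'a tuple monoid))) =
         card (carrier (polyperm_group :: ('a \<Rightarrow> 'a) monoid)) *
         (\<Prod>i = 1..n - 1.
            card (carrier (polyfun_ring i :: ('a point \<Rightarrow> 'a) ring)) *
            card (Units (polyfun_ring i :: ('a point \<Rightarrow> 'a) ring))))"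
proof -
  \<comment> \<open>The induction starts at 1, below the range of the claim: there both lists are
    empty and the product is 1, so that everything reduces to the isomorphism of the groups
    \<open>tri_group 1\<close> and \<open>polyperm_group\<close>.\<close>
  have "n \<ge> 1" using assms by simp
  then show ?thesis
  proof (induction n rule: nat_induct_at_least)
    case base
    have "card (carrier (tri_group 1 :: ('a point \<Rightarrow> 'a point) monoid)) =
        card (carrier (polyperm_group :: ('a \<Rightarrow> 'a) monoid))"
      by (rule iso_same_card[OF tri_group_1_iso])
    moreover have "rev [2..<Suc 1] = []" "rev [1..<1::nat] = []" "{1..1 - 1 :: nat} = {}"
      by simp_all
    ultimately show ?case
      using group_polyperm_group group_tri_group[OF order_refl] tri_group_1_iso
      by (simp only: list.map iterated_semidirect.simps prod.empty mult_1_right simp_thms)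
  next
    case (Suc m)
    \<comment> \<open>Reversal puts the newest factor at the head. The heads differ by one because
      \<open>Mlin\<close> is indexed by the coordinate it changes, the function ring by the number
      of variables of \<open>f\<close> and \<open>u\<close>.\<close>
    have lists: "rev [2..<Suc (Suc m)] = Suc m # rev [2..<Suc m]" "rev [1..<Suc m] = m # rev [1..<m]"
      using Suc.hyps by auto
    have "{1..Suc m - 1} = insert m {1..m - 1}"
      using Suc.hyps by auto
    moreover have "m \<notin> {1..m - 1}"
      using Suc.hyps by auto
    ultimately have prod: "(\<Prod>i = 1..Suc m - 1. c i) = c m * (\<Prod>i = 1..m - 1. c i)"
      for c :: "nat \<Rightarrow> nat"
      by simp
    note IH = Suc.IH[THEN conjunct1] Suc.IH[THEN conjunct2, THEN conjunct1]
      Suc.IH[THEN conjunct2, THEN conjunct2]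
    show ?case
      unfolding lists list.map iterated_semidirect.simps prod
    \<comment> \<open>The quotient \<open>C\<close> is left open in both decompositions and becomes
      \<open>tri_group m\<close> once the split sequences are applied.\<close>
    proof (intro conjI exI)
      show "card (carrier (tri_group (Suc m) :: ('a point \<Rightarrow> 'a point) monoid)) =
          card (carrier (polyperm_group :: ('a \<Rightarrow> 'a) monoid)) *
          (card (polyfuns m :: ('a point \<Rightarrow> 'a) set) * card (unitfuns m :: ('a point \<Rightarrow> 'a) set) *
          (\<Prod>i = 1..m - 1. card (polyfuns i :: ('a point \<Rightarrow> 'a) set) *
            card (unitfuns i :: ('a point \<Rightarrow> 'a) set)))"
        unfolding card_tri_group_Suc[OF Suc.hyps] IH(3) by (simp only: mult_ac)
    qed (rule semidirect_lin[OF Suc.hyps] semidirect_units[OF Suc.hyps] IH(1,2))+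
  qed
qed

end
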